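(* For any $k$-edge graph $H$ without isolated vertices, $AR_o(H) \leq k^2$. Moreover, $AR_o(P_k) \leq \binom{k}{2}+1$ for every $k\geq 1$, $AR_o(C_k) \leq \binom{k}{2}+1$ for every $k\geq 3$, and $AR_o(K_n) \leq n^4/4$ for every $n\geq 2$.
   Context: All graphs are finite and simple. $P_k$ is the path with $k$ edges, $C_k$ the cycle with $k$ edges, $K_n$ the complete graph on $n$ vertices. An edge-coloring (with natural numbers as colors) is proper if adjacent edges receive distinct colors; an edge-colored graph is rainbow if all its edges have distinct colors. A copy of $H$ is a (not necessarily induced) subgraph isomorphic to $H$. The online anti-Ramsey number $AR_o(H)$ is defined by a game between Builder and Painter: Builder creates vertices and edges, one edge at a time (the graph stays simple); immediately after each edge is built, Painter irrevocably colors it so that the coloring stays proper. Both players have complete information. $AR_o(H)$ is the smallest $t$ such that Builder has a strategy which, against every Painter, guarantees a rainbow copy of $H$ after at most $t$ edges have been built and colored. *)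

theory Defs
  imports "HOL-Library.Extended_Real"
begin

type_synonym 'a graph = "'a set \<times> 'a set set"

abbreviation verts :: "'a graph \<Rightarrow> 'a set" where
  "verts G \<equiv> fst G"

abbreviation edges :: "'a graph \<Rightarrow> 'a set set" where
  "edges G \<equiv> snd G"

definition simple_graph :: "'a graph \<Rightarrow> bool" where
  "simple_graph G \<longleftrightarrow> finite (verts G) \<and> (\<forall>e\<in>edges G. e \<subseteq> verts G \<and> card e = 2)"

definition no_isolated_vertices :: "'a graph \<Rightarrow> bool" where
  "no_isolated_vertices G \<longleftrightarrow> (\<forall>v\<in>verts G. \<exists>e\<in>edges G. v \<in> e)"

definition subgraph :: "'a graph \<Rightarrow> 'a graph \<Rightarrow> bool" where
  "subgraph F G \<longleftrightarrow> verts F \<subseteq> verts G \<and> edges F \<subseteq> edges G"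

definition isomorphic :: "'a graph \<Rightarrow> 'b graph \<Rightarrow> bool" where
  "isomorphic G H \<longleftrightarrow>
     (\<exists>f. bij_betw f (verts G) (verts H) \<and> (\<lambda>e. f ` e) ` edges G = edges H)"

definition path_graph :: "nat \<Rightarrow> nat graph" where
  "path_graph k = ({0..k}, {{i, i + 1} | i. i < k})"

text \<open>The following is the \<open>k\<close>-cycle for \<open>k \<ge> 3\<close> only.\<close>

definition cycle_graph :: "nat \<Rightarrow> nat graph" where
  "cycle_graph k = ({0..<k}, {{i, (i + 1) mod k} | i. i < k})"

definition complete_graph :: "nat \<Rightarrow> nat graph" where
  "complete_graph n = ({0..<n}, {e. e \<subseteq> {0..<n} \<and> card e = 2})"

definition proper_coloring :: "'a set set \<Rightarrow> ('a set \<Rightarrow> nat) \<Rightarrow> bool" where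
  "proper_coloring E c \<longleftrightarrow> (\<forall>e\<in>E. \<forall>f\<in>E. e \<noteq> f \<and> e \<inter> f \<noteq> {} \<longrightarrow> c e \<noteq> c f)"

definition rainbow :: "'a graph \<Rightarrow> ('a set \<Rightarrow> nat) \<Rightarrow> bool" where
  "rainbow G c \<longleftrightarrow> inj_on c (edges G)"

definition has_rainbow_copy :: "'a graph \<Rightarrow> 'b graph \<Rightarrow> ('b set \<Rightarrow> nat) \<Rightarrow> bool" where
  "has_rainbow_copy H G c \<longleftrightarrow> (\<exists>F. subgraph F G \<and> isomorphic H F \<and> rainbow F c)"

text \<open>
  A position is the list of the edges built so far, each with the color it received, in
  chronological order. Creating vertices is free and unlimited, so all vertices that Builder
  might ever create are taken from the infinite pool of natural numbers.
\<close>

type_synonym position = "(nat set \<times> nat) list"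

definition board :: "position \<Rightarrow> nat graph" where
  "board h = (UNIV, fst ` set h)"

definition color_of :: "position \<Rightarrow> nat set \<Rightarrow> nat" where
  "color_of h e = the (map_of h e)"

definition buildable :: "position \<Rightarrow> nat set \<Rightarrow> bool" where
  "buildable h e \<longleftrightarrow> card e = 2 \<and> e \<notin> edges (board h)"

text \<open>Legality is inherited by prefixes, so every stage of a legal position was legal.\<close>

definition legal :: "position \<Rightarrow> bool" where
  "legal h \<longleftrightarrow> distinct (map fst h) \<and> (\<forall>e\<in>edges (board h). card e = 2)
     \<and> proper_coloring (edges (board h)) (color_of h)"

definition builder_strategy :: "(position \<Rightarrow> nat set) \<Rightarrow> bool" where
  "builder_strategy \<sigma> \<longleftrightarrow> (\<forall>h. legal h \<longrightarrow> buildable h (\<sigma> h))"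

definition painter_strategy :: "(position \<Rightarrow> nat set \<Rightarrow> nat) \<Rightarrow> bool" where
  "painter_strategy \<pi> \<longleftrightarrow>
     (\<forall>h e. legal h \<and> buildable h e \<longrightarrow> legal (h @ [(e, \<pi> h e)]))"

primrec play ::
  "(position \<Rightarrow> nat set) \<Rightarrow> (position \<Rightarrow> nat set \<Rightarrow> nat) \<Rightarrow> nat \<Rightarrow> position" where
  "play \<sigma> \<pi> 0 = []"
| "play \<sigma> \<pi> (Suc s) =
     (let h = play \<sigma> \<pi> s; e = \<sigma> h in h @ [(e, \<pi> h e)])"

definition builder_wins_within :: "'a graph \<Rightarrow> nat \<Rightarrow> bool" where
  "builder_wins_within H t \<longleftrightarrow>
     (\<exists>\<sigma>. builder_strategy \<sigma> \<and>
        (\<forall>\<pi>. painter_strategy \<pi> \<longrightarrow>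
           (\<exists>s\<le>t. has_rainbow_copy H (board (play \<sigma> \<pi> s)) (color_of (play \<sigma> \<pi> s)))))"

text \<open>
  The infimum in the extended naturals is the minimum if Builder can win within a bounded
  number of edges, and \<open>\<infinity>\<close> otherwise; a finite upper bound thus includes the
  existence of a winning strategy.
\<close>

definition AR_o :: "'a graph \<Rightarrow> enat" where
  "AR_o H = Inf (enat ` {t. builder_wins_within H t})"

end

theory Submission imports Defs begin

text \<open>
  Builder grows a rainbow copy vertex by vertex, never changing what is already embedded: a fresh
  vertex \<open>w\<close> is joined to the required embedded vertices one after the other, and \<open>w\<close> is discarded as
  soon as an edge to some \<open>u\<close> receives a color of the current copy. Since the coloring is proper and
  the palette only grows, such an edge uses up the pair of \<open>u\<close> and its color for the rest of the game.
  If \<open>w\<close> is always tested in the order in which the vertices were embedded, then a failure at \<open>u\<close>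
  costs at most the position of \<open>u\<close> among the tested vertices.

  For general \<open>H\<close> the next vertex is always one with the most neighbors among the earlier ones, and
  \<open>d\<close> denotes the number of these neighbors. Failures at the \<open>j\<close>-th vertex then cost at most the
  \<open>d\<close> of the \<open>(j + 1)\<close>-st vertex, by its maximality, and these numbers sum to at most \<open>k\<close>. With at
  most \<open>k\<close> colors per vertex this gives \<open>k\<^sup>2\<close>.

  For a cycle, Builder first makes a rainbow path with \<open>i = k - 3\<close> edges and ends \<open>a\<close> and \<open>b\<close>, then
  extends it at \<open>a\<close>, and then tries to extend it at \<open>b\<close> until either as many failures have occurred
  at \<open>b\<close> as at \<open>a\<close> or an extension succeeds. The resulting path with \<open>i + 1\<close> edges is closed by a
  fresh vertex, whose edge to the end with fewer remaining failures is tested last; at most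
  \<open>3 i + 3\<close> edges are spent after the path with \<open>i\<close> edges.
\<close>

section \<open>Forcing by Builder, and how it yields a strategy\<close>

text \<open>A derivation is a well-founded tree: Builder chooses the edge at a node, and the
  branches are Painter's legal colors. Arguments about the game then compose by
  \<open>forces_bind\<close> without explicit strategies; bounds on the number of edges are part of
  \<open>Q\<close>.\<close>

inductive forces :: "(position \<Rightarrow> bool) \<Rightarrow> position \<Rightarrow> bool" for Q where
  forces_stop: "Q h \<Longrightarrow> forces Q h"
| forces_step: "buildable h e \<Longrightarrow> (\<And>c. legal (h @ [(e, c)]) \<Longrightarrow> forces Q (h @ [(e, c)])) \<Longrightarrow> forces Q h"

lemma forces_bind:
  assumes "forces Q h" "\<And>h'. Q h' \<Longrightarrow> forces R h'"
  shows "forces R h"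
  using assms(1) by induction (auto intro: assms(2) forces_step)

text \<open>A node without legal replies would make \<open>forces_step\<close> vacuous; a Painter
  strategy supplies a legal reply at every node, so some branch really ends in \<open>Q\<close>.
  Positions only grow along a branch.\<close>

lemma forces_reaches:
  assumes "forces Q h" "legal h" "painter_strategy \<pi>"
  shows "\<exists>h'. Q h' \<and> length h \<le> length h'"
  using assms(1,2)
proof induction
  case (forces_step h e)
  then have "legal (h @ [(e, \<pi> h e)])"
    using assms(3) unfolding painter_strategy_def by blast
  with forces_step.IH show ?case
    by fastforce
qed auto

lemma legal_card: "legal h \<Longrightarrow> (e, c) \<in> set h \<Longrightarrow> card e = 2"
  by (force simp: legal_def board_def)

lemma legal_color_of: "legal h \<Longrightarrow> (e, c) \<in> set h \<Longrightarrow> color_of h e = c"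
  by (simp add: legal_def color_of_def)

lemma legal_color_unique:
  assumes "legal h" "(e, c) \<in> set h" "(e', c) \<in> set h" "v \<in> e" "v \<in> e'"
  shows "e = e'"
proof (rule ccontr)
  assume "e \<noteq> e'"
  moreover have "e \<in> edges (board h)" "e' \<in> edges (board h)"
    using assms by (force simp: board_def)+
  ultimately have "color_of h e \<noteq> color_of h e'"
    using assms unfolding legal_def proper_coloring_def by blast
  then show False
    using assms legal_color_of by metis
qed

lemma edge_board_iff: "legal h \<Longrightarrow> e \<in> edges (board h) \<longleftrightarrow> (e, color_of h e) \<in> set h"
  by (auto simp: board_def legal_color_of) (force)

lemma ex_fresh_vertex:
  assumes "legal h" "finite X"
  shows "\<exists>w::nat. w \<notin> X \<and> (\<forall>e\<in>fst ` set h. w \<notin> e)"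
proof -
  have "finite e" if "e \<in> fst ` set h" for e
    using that legal_card[OF assms(1)] by (force intro: card_ge_0_finite)
  then have "finite (X \<union> \<Union> (fst ` set h))"
    using assms(2) by auto
  from ex_new_if_finite[OF infinite_UNIV_nat this] show ?thesis
    by auto
qed

lemma ex_buildable:
  assumes "legal h"
  shows "\<exists>e. buildable h e"
proof -
  obtain w where w: "w \<notin> {0::nat}" "\<forall>e\<in>fst ` set h. w \<notin> e"
    using ex_fresh_vertex[OF assms, of "{0}"] by auto
  then have "buildable h {0, w}"
    by (auto simp: buildable_def board_def)
  then show ?thesis ..
qed

text \<open>Builder always moves so that the target stays forced. The edges chosen need not follow
  one derivation, so termination comes from the length bound in the target instead.\<close>

lemma forces_imp_builder_wins:
  assumes f: "forces (\<lambda>h. has_rainbow_copy H (board h) (color_of h) \<and> length h \<le> t) []"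
  shows "builder_wins_within H t"
proof -
  define Q where "Q = (\<lambda>h. has_rainbow_copy H (board h) (color_of h) \<and> length h \<le> t)"
  define ok where "ok h e \<longleftrightarrow> (\<forall>c. legal (h @ [(e, c)]) \<longrightarrow> forces Q (h @ [(e, c)]))" for h e
  \<comment> \<open>Outside the winning region any buildable edge is taken, since a strategy must
    answer every legal position.\<close>
  define \<sigma> where "\<sigma> h = (SOME e. buildable h e \<and> ((\<exists>e. buildable h e \<and> ok h e) \<longrightarrow> ok h e))" for h
  have \<sigma>: "buildable h (\<sigma> h) \<and> ((\<exists>e. buildable h e \<and> ok h e) \<longrightarrow> ok h (\<sigma> h))" if "legal h" for h
    unfolding \<sigma>_def by (rule someI_ex) (use ex_buildable[OF that] in blast)
  have "\<exists>s\<le>t. has_rainbow_copy H (board (play \<sigma> \<pi> s)) (color_of (play \<sigma> \<pi> s))"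
    if \<pi>: "painter_strategy \<pi>" for \<pi>
  proof (rule ccontr)
    assume no: "\<not> ?thesis"
    have len: "length (play \<sigma> \<pi> s) = s" for s
      by (induction s) (auto simp: Let_def)
    \<comment> \<open>One move past \<open>t\<close> is what matters: a target position reachable
      from there would have more than \<open>t\<close> edges.\<close>
    have "s \<le> Suc t \<Longrightarrow> legal (play \<sigma> \<pi> s) \<and> forces Q (play \<sigma> \<pi> s)" for s
    proof (induction s)
      case 0
      then show ?case
        using f by (simp add: Q_def legal_def board_def proper_coloring_def)
    next
      case (Suc s)
      define h where "h = play \<sigma> \<pi> s"
      have h: "legal h" "forces Q h"
        using Suc by (auto simp: h_def)
      have "\<not> Q h"
        using no Suc.prems by (auto simp: Q_def h_def)
      with h(2) have "\<exists>e. buildable h e \<and> ok h e"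
        by (cases rule: forces.cases) (auto simp: ok_def)
      with \<sigma>[OF h(1)] have *: "buildable h (\<sigma> h)" "ok h (\<sigma> h)"
        by auto
      then have "legal (h @ [(\<sigma> h, \<pi> h (\<sigma> h))])"
        using \<pi> h(1) unfolding painter_strategy_def by blast
      with *(2) show ?case
        by (simp add: ok_def Let_def h_def)
    qed
    from this[of "Suc t"] obtain h' where "Q h'" "Suc t \<le> length h'"
      using forces_reaches[of Q "play \<sigma> \<pi> (Suc t)" \<pi>] \<pi> len[of "Suc t"] by auto
    then show False
      by (simp add: Q_def)
  qed
  with \<sigma> show ?thesis
    unfolding builder_wins_within_def builder_strategy_def by blast
qed

lemma AR_o_le: "forces (\<lambda>h. has_rainbow_copy H (board h) (color_of h) \<and> length h \<le> t) [] \<Longrightarrow> AR_o H \<le> enat t"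
  unfolding AR_o_def by (rule Inf_lower) (auto dest: forces_imp_builder_wins)

section \<open>Counting the failures still possible at a vertex\<close>

text \<open>
  \<open>unseen h S v\<close> is the number of failures with colors of \<open>S\<close> that can still happen at \<open>v\<close>.
\<close>

definition seen :: "position \<Rightarrow> nat \<Rightarrow> nat set" where
  "seen h v = {c. \<exists>e. (e, c) \<in> set h \<and> v \<in> e}"

definition unseen :: "position \<Rightarrow> nat set \<Rightarrow> nat \<Rightarrow> nat" where
  "unseen h S v = card (S - seen h v)"

lemma seen_mono: "set h \<subseteq> set h' \<Longrightarrow> seen h v \<subseteq> seen h' v"
  by (auto simp: seen_def)

lemma unseen_mono: "finite S \<Longrightarrow> set h \<subseteq> set h' \<Longrightarrow> unseen h' S v \<le> unseen h S v"
  unfolding unseen_def using seen_mono[of h h' v] by (intro card_mono) auto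

lemma unseen_le: "finite S \<Longrightarrow> unseen h S v \<le> card S"
  unfolding unseen_def by (intro card_mono) auto

lemma unseen_less: "finite S \<Longrightarrow> c \<in> S \<Longrightarrow> c \<in> seen h v \<Longrightarrow> unseen h S v < card S"
  unfolding unseen_def by (intro psubset_card_mono) auto

lemma unseen_Un_le:
  assumes "finite S" "finite D"
  shows "unseen h (S \<union> D) v \<le> unseen h S v + unseen h D v"
proof -
  have "S \<union> D - seen h v = (S - seen h v) \<union> (D - seen h v)"
    by auto
  then show ?thesis
    by (simp add: unseen_def card_Un_le)
qed

lemma unseen_append_notin: "c \<notin> S \<Longrightarrow> unseen (h @ [(e, c)]) S v = unseen h S v"
  unfolding unseen_def by (rule arg_cong[of _ _ card]) (auto simp: seen_def)

text \<open>This is where properness enters: an earlier edge at \<open>v\<close> of color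
  \<open>c\<close> would be adjacent to \<open>e\<close>, so \<open>c\<close> is new at
  \<open>v\<close>.\<close>

lemma unseen_append_in:
  assumes "legal (h @ [(e, c)])" "finite S" "c \<in> S" "v \<in> e"
  shows "unseen (h @ [(e, c)]) S v < unseen h S v"
  unfolding unseen_def
proof (rule psubset_card_mono)
  have "c \<notin> seen h v"
  proof
    assume "c \<in> seen h v"
    then obtain e' where e': "(e', c) \<in> set h" "v \<in> e'"
      by (auto simp: seen_def)
    with legal_color_unique[OF assms(1), of e' c e v] assms(4) have "e' = e"
      by auto
    with e' assms(1) show False
      by (force simp: legal_def)
  qed
  moreover have "c \<in> seen (h @ [(e, c)]) v"
    using assms(4) by (auto simp: seen_def)
  ultimately show "S - seen (h @ [(e, c)]) v \<subset> S - seen h v"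
    using assms(3) seen_mono[of h "h @ [(e, c)]" v] by auto
qed (use assms in auto)

section \<open>Testing fresh vertices against a potential\<close>

text \<open>The state in the middle of a test: \<open>w\<close> is joined to the first
  \<open>q\<close> entries of \<open>us\<close> with colors outside \<open>S\<close>, and to none of
  the others. A success raises the length and \<open>q\<close> by one each. A failure resets
  \<open>q\<close> to 0, but lowers \<Phi> by at least \<open>q + 1\<close>. So the budget
  inequality with \<open>B + q\<close> is invariant.\<close>

lemma forces_attach_aux:
  fixes \<phi> p :: "nat \<Rightarrow> nat" and us I :: _ and S X :: "nat set"
  defines "\<Phi> \<equiv> \<lambda>h. \<Sum>j\<in>I. p j * unseen h S (\<phi> j)"
  assumes fin: "finite S" "finite X" "finite I"
    and us: "set us \<subseteq> I" "distinct us" "inj_on \<phi> (set us)" "\<phi> ` set us \<subseteq> X"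
    and p: "\<And>q. q < length us \<Longrightarrow> q < p (us ! q)"
    and h: "legal h" "set h0 \<subseteq> set h" "w \<notin> X" "q \<le> length us"
      "\<forall>j\<in>set (take q us). \<exists>c. c \<notin> S \<and> ({\<phi> j, w}, c) \<in> set h"
      "\<forall>j\<in>set (drop q us). {\<phi> j, w} \<notin> fst ` set h"
      "\<tau> \<le> \<Phi> h" "length h + \<Phi> h + length us \<le> B + q"
  shows "forces (\<lambda>h'. legal h' \<and> set h0 \<subseteq> set h' \<and>
     (\<Phi> h' < \<tau> \<and> length h' + \<Phi> h' + length us \<le> B \<or>
      \<tau> \<le> \<Phi> h' \<and> length h' + \<Phi> h' \<le> B \<and>
        (\<exists>w. w \<notin> X \<and> (\<forall>j\<in>set us. \<exists>c. c \<notin> S \<and> ({\<phi> j, w}, c) \<in> set h')))) h"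
  (is "forces ?Q h")
  using h
proof (induction "B - length h" arbitrary: h w q rule: less_induct)
  case less
  note h = less.prems
  show ?case
  proof (cases "q = length us")
    case True
    then show ?thesis
      using h by (intro forces_stop) auto
  next
    case False
    define j where "j = us ! q"
    have q: "q < length us" and j: "j \<in> set us"
      using False h(4) by (auto simp: j_def)
    have drop: "drop q us = j # drop (Suc q) us"
      using q by (simp add: Cons_nth_drop_Suc j_def)
    have take: "take (Suc q) us = take q us @ [j]"
      using q by (simp add: take_Suc_conv_app_nth j_def)
    let ?e = "{\<phi> j, w}"
    have w: "w \<noteq> \<phi> i" if "i \<in> set us" for i
      using that us(4) h(3) by auto
    have "buildable h ?e"
      using h(6) drop w[OF j] by (auto simp: buildable_def board_def)
    then show ?thesis
    proof (rule forces_step)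
      fix c assume leg: "legal (h @ [(?e, c)])"
      let ?h = "h @ [(?e, c)]"
      \<comment> \<open>As \<open>q < length us\<close>, the budget inequality gives
        \<open>length h < B\<close>, so the measure really decreases.\<close>
      have meas: "B - length ?h < B - length h"
        using q h(8) by simp
      show "forces ?Q ?h"
      proof (cases "c \<in> S")
        case False
        have \<Phi>: "\<Phi> ?h = \<Phi> h"
          using False by (simp add: \<Phi>_def unseen_append_notin)
        have neq: "{\<phi> i, w} \<noteq> ?e" if "i \<in> set (drop (Suc q) us)" for i
        proof -
          have "i \<noteq> j"
            using that us(2) drop distinct_drop[of us q] by auto
          moreover have "i \<in> set us"
            using that by (auto dest: in_set_dropD)
          ultimately have "\<phi> i \<noteq> \<phi> j"
            using us(3) j by (auto dest: inj_onD)
          then show ?thesis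
            using w[OF j] by (auto simp: doubleton_eq_iff)
        qed
        show ?thesis
        proof (rule less.hyps[OF meas leg, where w = w and q = "Suc q"])
          show "\<forall>j\<in>set (take (Suc q) us). \<exists>c. c \<notin> S \<and> ({\<phi> j, w}, c) \<in> set ?h"
            unfolding take using h(5) False by auto
          show "\<forall>j\<in>set (drop (Suc q) us). {\<phi> j, w} \<notin> fst ` set ?h"
            using h(6) drop neq by auto
        qed (use h q \<Phi> in auto)
      next
        case True
        \<comment> \<open>The term of \<open>j\<close> loses at least \<open>p j\<close>, and no
          other term can grow.\<close>
        have "\<Phi> ?h + p j \<le> \<Phi> h"
        proof -
          have jI: "j \<in> I"
            using j us(1) by auto
          have "Suc (unseen ?h S (\<phi> j)) \<le> unseen h S (\<phi> j)"
            using unseen_append_in[OF leg fin(1) True, of "\<phi> j"] by simp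
          then have "p j * unseen ?h S (\<phi> j) + p j \<le> p j * unseen h S (\<phi> j)"
            by (metis add.commute mult_Suc_right mult_le_mono2)
          moreover have "(\<Sum>i\<in>I - {j}. p i * unseen ?h S (\<phi> i)) \<le> (\<Sum>i\<in>I - {j}. p i * unseen h S (\<phi> i))"
            by (intro sum_mono mult_le_mono2 unseen_mono) (use fin in auto)
          ultimately show ?thesis
            unfolding \<Phi>_def using fin(3) jI by (simp add: sum.remove)
        qed
        \<comment> \<open>The drop pays for the failing edge and for the \<open>q\<close> good edges
          at \<open>w\<close> that are now discarded.\<close>
        moreover have "q < p j"
          using p[OF q] by (simp add: j_def)
        ultimately have len: "length ?h + \<Phi> ?h + length us \<le> B"
          using h(8) by simp
        show ?thesis
        proof (cases "\<Phi> ?h < \<tau>")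
          case True
          then show ?thesis
            using len leg h(2) by (intro forces_stop) auto
        next
          case False
          obtain w' where w': "w' \<notin> X" "\<forall>e\<in>fst ` set ?h. w' \<notin> e"
            using ex_fresh_vertex[OF leg fin(2)] by auto
          show ?thesis
          proof (rule less.hyps[OF meas leg, where w = w' and q = 0])
            show "\<forall>j\<in>set (drop 0 us). {\<phi> j, w'} \<notin> fst ` set ?h"
              using w'(2) by blast
          qed (use h w' False len in auto)
        qed
      qed
    qed
  qed
qed

text \<open>
  \<open>\<Phi>\<close> is a potential paying for the failures. The first alternative lets Builder give up on
  attaching a vertex once \<open>\<Phi>\<close> has fallen below the threshold \<open>\<tau>\<close>.
\<close>

lemma forces_attach_or_saturate:
  fixes \<phi> p :: "nat \<Rightarrow> nat" and us I :: _ and S X :: "nat set"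
  defines "\<Phi> \<equiv> \<lambda>h. \<Sum>j\<in>I. p j * unseen h S (\<phi> j)"
  assumes fin: "finite S" "finite X" "finite I"
    and us: "set us \<subseteq> I" "distinct us" "inj_on \<phi> (set us)" "\<phi> ` set us \<subseteq> X"
    and p: "\<And>q. q < length us \<Longrightarrow> q < p (us ! q)"
    and h: "legal h"
  shows "forces (\<lambda>h'. legal h' \<and> set h \<subseteq> set h' \<and>
     (\<Phi> h' < \<tau> \<and> length h' + \<Phi> h' \<le> length h + \<Phi> h \<or>
      \<tau> \<le> \<Phi> h' \<and> length h' + \<Phi> h' \<le> length h + \<Phi> h + length us \<and>
        (\<exists>w. w \<notin> X \<and> (\<forall>j\<in>set us. \<exists>c. c \<notin> S \<and> ({\<phi> j, w}, c) \<in> set h')))) h"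
proof (cases "\<Phi> h < \<tau>")
  case True
  then show ?thesis
    using h by (intro forces_stop) auto
next
  case False
  obtain w where w: "w \<notin> X" "\<forall>e\<in>fst ` set h. w \<notin> e"
    using ex_fresh_vertex[OF h fin(2)] by auto
  \<comment> \<open>The budget \<open>B\<close> is \<open>length h + \<Phi> h + length us\<close>.
    Giving up happens right after a failure, when no edge of an attached vertex has to be paid for,
    so \<open>length us\<close> cancels there.\<close>
  have "forces (\<lambda>h'. legal h' \<and> set h \<subseteq> set h' \<and>
     (\<Phi> h' < \<tau> \<and> length h' + \<Phi> h' + length us \<le> length h + \<Phi> h + length us \<or>
      \<tau> \<le> \<Phi> h' \<and> length h' + \<Phi> h' \<le> length h + \<Phi> h + length us \<and>
        (\<exists>w. w \<notin> X \<and> (\<forall>j\<in>set us. \<exists>c. c \<notin> S \<and> ({\<phi> j, w}, c) \<in> set h')))) h"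
    unfolding \<Phi>_def
  proof (rule forces_attach_aux[OF fin us p h, where q = 0 and w = w])
    show "\<forall>j\<in>set (drop 0 us). {\<phi> j, w} \<notin> fst ` set h"
      using w(2) by blast
  qed (use False w in \<open>auto simp: \<Phi>_def\<close>)
  then show ?thesis
    by simp
qed

text \<open>With threshold 0 the potential cannot fall below it, so only success remains.\<close>

lemma forces_attach:
  fixes \<phi> p :: "nat \<Rightarrow> nat" and us I :: _ and S X :: "nat set"
  defines "\<Phi> \<equiv> \<lambda>h. \<Sum>j\<in>I. p j * unseen h S (\<phi> j)"
  assumes fin: "finite S" "finite X" "finite I"
    and us: "set us \<subseteq> I" "distinct us" "inj_on \<phi> (set us)" "\<phi> ` set us \<subseteq> X"
    and p: "\<And>q. q < length us \<Longrightarrow> q < p (us ! q)"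
    and h: "legal h"
  shows "forces (\<lambda>h'. legal h' \<and> set h \<subseteq> set h' \<and>
      length h' + \<Phi> h' \<le> length h + \<Phi> h + length us \<and>
        (\<exists>w. w \<notin> X \<and> (\<forall>j\<in>set us. \<exists>c. c \<notin> S \<and> ({\<phi> j, w}, c) \<in> set h'))) h"
  using forces_attach_or_saturate[OF fin us p h, of 0] by (simp add: \<Phi>_def)

section \<open>Rainbow embeddings and their extension by one vertex\<close>

text \<open>The embedding is an explicit map, not just the existence of a copy, because later
  vertices extend this very map.\<close>

definition rainbow_embedding :: "nat graph \<Rightarrow> (nat \<Rightarrow> nat) \<Rightarrow> position \<Rightarrow> bool" where
  "rainbow_embedding G f h \<longleftrightarrow> inj_on f (verts G) \<and>
     (\<forall>e\<in>edges G. e \<subseteq> verts G \<and> f ` e \<in> edges (board h)) \<and>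
     inj_on (\<lambda>e. color_of h (f ` e)) (edges G)"

definition palette :: "nat graph \<Rightarrow> (nat \<Rightarrow> nat) \<Rightarrow> position \<Rightarrow> nat set" where
  "palette G f h = (\<lambda>e. color_of h (f ` e)) ` edges G"

definition attach_vertex :: "nat graph \<Rightarrow> nat \<Rightarrow> nat set \<Rightarrow> nat graph" where
  "attach_vertex G v N = (insert v (verts G), edges G \<union> (\<lambda>u. {u, v}) ` N)"

lemma rainbow_embedding_imp_copy:
  assumes "rainbow_embedding G f h"
  shows "has_rainbow_copy G (board h) (color_of h)"
proof -
  let ?F = "(f ` verts G, image f ` edges G)"
  have "inj_on (color_of h \<circ> image f) (edges G)"
    using assms by (simp add: rainbow_embedding_def comp_def)
  then have "rainbow ?F (color_of h)"
    by (simp add: rainbow_def inj_on_imageI)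
  moreover have "subgraph ?F (board h)"
    using assms by (auto simp: subgraph_def rainbow_embedding_def board_def)
  moreover have "isomorphic G ?F"
    using assms unfolding isomorphic_def rainbow_embedding_def
    by (intro exI[of _ f]) (auto intro: inj_on_imp_bij_betw)
  ultimately show ?thesis
    unfolding has_rainbow_copy_def by blast
qed

lemma card_palette: "rainbow_embedding G f h \<Longrightarrow> card (palette G f h) = card (edges G)"
  by (simp add: rainbow_embedding_def palette_def card_image)

lemma color_of_extend:
  assumes "legal h" "legal h'" "set h \<subseteq> set h'" "e \<in> edges (board h)"
  shows "color_of h' e = color_of h e"
  using assms edge_board_iff legal_color_of by blast

lemma rainbow_embedding_extend:
  assumes "rainbow_embedding G f h" "legal h" "legal h'" "set h \<subseteq> set h'"
  shows "rainbow_embedding G f h'" "palette G f h' = palette G f h"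
proof -
  have eq: "color_of h' (f ` e) = color_of h (f ` e)" if "e \<in> edges G" for e
    using that assms by (intro color_of_extend) (auto simp: rainbow_embedding_def)
  show "palette G f h' = palette G f h"
    using eq by (auto simp: palette_def)
  have "inj_on (\<lambda>e. color_of h' (f ` e)) (edges G) \<longleftrightarrow> inj_on (\<lambda>e. color_of h (f ` e)) (edges G)"
    using eq by (intro inj_on_cong) auto
  then show "rainbow_embedding G f h'"
    using assms(1) image_mono[OF assms(4), of fst] by (auto simp: rainbow_embedding_def board_def)
qed

text \<open>The copy's own edge at \<open>f v\<close> has already used up one palette color
  there.\<close>

lemma unseen_palette_less:
  assumes "rainbow_embedding G f h" "legal h" "finite (edges G)" "e \<in> edges G" "v \<in> e"
  shows "unseen h (palette G f h) (f v) < card (edges G)"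
proof -
  have "color_of h (f ` e) \<in> palette G f h"
    using assms by (auto simp: palette_def)
  moreover have "(f ` e, color_of h (f ` e)) \<in> set h"
    using assms edge_board_iff by (auto simp: rainbow_embedding_def)
  then have "color_of h (f ` e) \<in> seen h (f v)"
    using assms(5) unfolding seen_def by blast
  ultimately show ?thesis
    using unseen_less[of "palette G f h"] assms(3) card_palette[OF assms(1)]
    by (simp add: palette_def)
qed

text \<open>The new edges all meet in \<open>w\<close>, so properness makes their colors distinct,
  and they avoid the old palette by assumption. The last conclusion records that each neighbor has
  already seen one of the new colors, a saving that later pays for the new edges.\<close>

lemma rainbow_embedding_attach:
  assumes G: "rainbow_embedding G f h" and h: "legal h" "legal h'" "set h \<subseteq> set h'"
    and v: "v \<notin> verts G" and N: "N \<subseteq> verts G" and w: "w \<notin> f ` verts G"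
    and new: "\<forall>u\<in>N. \<exists>c. c \<notin> palette G f h \<and> ({f u, w}, c) \<in> set h'"
  obtains D where "rainbow_embedding (attach_vertex G v N) (f(v := w)) h'"
    "palette (attach_vertex G v N) (f(v := w)) h' = palette G f h \<union> D"
    "card D = card N" "\<And>u. u \<in> N \<Longrightarrow> D \<inter> seen h' (f u) \<noteq> {}"
proof -
  let ?G = "attach_vertex G v N" and ?f = "f(v := w)"
  obtain c where c: "\<And>u. u \<in> N \<Longrightarrow> c u \<notin> palette G f h \<and> ({f u, w}, c u) \<in> set h'"
    using new by metis
  note G' = rainbow_embedding_extend[OF G h]
  have old: "?f ` e = f ` e" if "e \<in> edges G" for e
  proof -
    have "v \<notin> e"
      using that G v by (auto simp: rainbow_embedding_def)
    then show ?thesis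
      by (intro image_cong) auto
  qed
  have newim: "?f ` {u, v} = {f u, w}" if "u \<in> N" for u
    using that N v by auto
  have newcol: "color_of h' {f u, w} = c u" if "u \<in> N" for u
    using c[OF that] legal_color_of[OF h(2)] by auto
  have injf: "inj_on f (verts G)"
    using G by (simp add: rainbow_embedding_def)
  have injc: "inj_on c N"
  proof (rule inj_onI)
    fix u u' assume u: "u \<in> N" "u' \<in> N" "c u = c u'"
    then have "{f u, w} = {f u', w}"
      using legal_color_unique[OF h(2), of "{f u, w}" "c u" "{f u', w}" w] c[OF u(1)] c[OF u(2)] by simp
    moreover have "f u \<noteq> w" "f u' \<noteq> w"
      using u N w by auto
    ultimately have "f u = f u'"
      by (auto simp: doubleton_eq_iff)
    then show "u = u'"
      using injf u N by (auto dest: inj_onD)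
  qed
  have pal: "palette ?G ?f h' = palette G f h \<union> c ` N"
  proof -
    have "palette ?G ?f h' = (\<lambda>e. color_of h' (?f ` e)) ` edges G \<union> (\<lambda>u. color_of h' (?f ` {u, v})) ` N"
      by (simp add: palette_def attach_vertex_def image_Un image_image del: fun_upd_apply image_insert)
    also have "(\<lambda>e. color_of h' (?f ` e)) ` edges G = palette G f h'"
      unfolding palette_def by (intro image_cong refl) (simp only: old)
    also have "(\<lambda>u. color_of h' (?f ` {u, v})) ` N = c ` N"
      by (intro image_cong) (simp_all only: newim newcol)
    finally show ?thesis
      by (simp only: G'(2))
  qed
  define col where "col = (\<lambda>e. color_of h' (?f ` e))"
  have col_old: "col e = color_of h' (f ` e)" if "e \<in> edges G" for e
    unfolding col_def old[OF that] ..
  have col_new: "col {u, v} = c u" if "u \<in> N" for u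
    unfolding col_def newim[OF that] newcol[OF that] ..
  have "inj_on col (edges G \<union> (\<lambda>u. {u, v}) ` N)"
    unfolding inj_on_Un
  proof (intro conjI)
    show "inj_on col (edges G)"
      using G'(1) col_old inj_on_cong[of "edges G" col "\<lambda>e. color_of h' (f ` e)"]
      by (auto simp: rainbow_embedding_def)
    show "inj_on col ((\<lambda>u. {u, v}) ` N)"
      using injc col_new inj_on_cong[of N "\<lambda>u. col {u, v}" c]
      by (intro inj_on_imageI) (simp add: comp_def)
    have "col ` edges G = palette G f h'"
      unfolding palette_def using col_old by (intro image_cong) auto
    also note G'(2)
    finally have "col ` (edges G - (\<lambda>u. {u, v}) ` N) \<subseteq> palette G f h"
      using image_mono[of "edges G - (\<lambda>u. {u, v}) ` N" "edges G" col] by simp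
    moreover have "\<forall>u\<in>N. col {u, v} \<notin> palette G f h"
      using c col_new by simp
    then have "col ` ((\<lambda>u. {u, v}) ` N - edges G) \<inter> palette G f h = {}"
      by auto
    ultimately show "col ` (edges G - (\<lambda>u. {u, v}) ` N) \<inter> col ` ((\<lambda>u. {u, v}) ` N - edges G) = {}"
      by (meson disjoint_iff subsetD)
  qed
  moreover have "inj_on ?f (insert v (verts G))"
    using injf v w by (auto simp: inj_on_def)
  moreover have "\<forall>e\<in>edges G. e \<subseteq> verts G \<and> ?f ` e \<in> edges (board h')"
    using G'(1) old by (auto simp: rainbow_embedding_def simp del: fun_upd_apply)
  moreover have "\<forall>u\<in>N. ?f ` {u, v} \<in> edges (board h')"
    using newim c by (force simp: board_def simp del: image_insert fun_upd_apply)
  ultimately have "rainbow_embedding ?G ?f h'"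
    using N unfolding rainbow_embedding_def attach_vertex_def col_def by auto
  moreover have "c ` N \<inter> seen h' (f u) \<noteq> {}" if "u \<in> N" for u
    using c[OF that] that by (force simp: seen_def)
  ultimately show ?thesis
    using that[of "c ` N"] pal injc by (simp add: card_image)
qed

section \<open>Paths and cycles as successive attachments\<close>

lemma path_graph_Suc: "path_graph (Suc j) = attach_vertex (path_graph j) (Suc j) {j}"
  by (auto simp: path_graph_def attach_vertex_def less_Suc_eq)

lemma verts_path_graph: "verts (path_graph j) = {0..j}"
  by (simp add: path_graph_def)

lemma edges_path_graph: "edges (path_graph j) = (\<lambda>i. {i, Suc i}) ` {..<j}"
  by (auto simp: path_graph_def)

text \<open>Only the edge leaving \<open>Suc j\<close> wraps around, to 0. Closing a cycle thus
  becomes a single attachment with two tested neighbors.\<close>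

lemma cycle_graph_eq_attach:
  "cycle_graph (j + 2) = attach_vertex (path_graph j) (Suc j) {j, 0}"
proof -
  have "edges (cycle_graph (j + 2)) = (\<lambda>i. {i, (i + 1) mod (j + 2)}) ` {..<j + 2}"
    by (auto simp: cycle_graph_def)
  also have "{..<j + 2} = {..<j} \<union> {j, Suc j}"
    by auto
  also have "(\<lambda>i. {i, (i + 1) mod (j + 2)}) ` \<dots> =
      (\<lambda>i. {i, (i + 1) mod (j + 2)}) ` {..<j} \<union> {{j, Suc j}, {0, Suc j}}"
    by (simp add: image_Un insert_commute)
  also have "(\<lambda>i. {i, (i + 1) mod (j + 2)}) ` {..<j} = edges (path_graph j)"
    unfolding edges_path_graph by (intro image_cong) auto
  finally have "edges (cycle_graph (j + 2)) = edges (attach_vertex (path_graph j) (Suc j) {j, 0})"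
    by (simp add: attach_vertex_def)
  moreover have "verts (cycle_graph (j + 2)) = verts (attach_vertex (path_graph j) (Suc j) {j, 0})"
    by (auto simp: cycle_graph_def attach_vertex_def path_graph_def)
  ultimately show ?thesis
    by (rule prod_eqI[rotated])
qed

lemma card_edges_path_graph: "card (edges (path_graph j)) = j"
proof -
  have "inj_on (\<lambda>i::nat. {i, Suc i}) {..<j}"
    by (auto simp: inj_on_def doubleton_eq_iff)
  then show ?thesis
    by (simp add: edges_path_graph card_image)
qed

text \<open>Reflection is an automorphism of the path; it makes extension at the last vertex
  available at the first one too.\<close>

lemma rainbow_embedding_path_rev:
  assumes "rainbow_embedding (path_graph j) f h"
  shows "rainbow_embedding (path_graph j) (\<lambda>i. f (j - i)) h"
    "palette (path_graph j) (\<lambda>i. f (j - i)) h = palette (path_graph j) f h"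
proof -
  let ?r = "\<lambda>i. j - i"
  have r: "?r ` {i, Suc i} = {j - Suc i, Suc (j - Suc i)}" if "i < j" for i
    using that by auto
  have sub: "image ?r ` edges (path_graph j) \<subseteq> edges (path_graph j)"
    using r by (auto simp: edges_path_graph)
  have le: "e \<subseteq> {..j}" if "e \<in> edges (path_graph j)" for e
    using that by (auto simp: edges_path_graph)
  have inv: "?r ` ?r ` e = e" if "e \<in> edges (path_graph j)" for e
    using le[OF that] by (force simp: image_image)
  have bij: "bij_betw (image ?r) (edges (path_graph j)) (edges (path_graph j))"
    using sub inv by (intro bij_betw_byWitness[of _ "image ?r"]) auto
  have im: "(\<lambda>i. f (j - i)) ` e = f ` (?r ` e)" for e
    by (simp add: image_image)
  have comp: "(\<lambda>e. color_of h ((\<lambda>i. f (j - i)) ` e)) = (\<lambda>e. color_of h (f ` e)) \<circ> image ?r"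
    by (simp add: fun_eq_iff im)
  show "palette (path_graph j) (\<lambda>i. f (j - i)) h = palette (path_graph j) f h"
    unfolding palette_def comp image_comp[symmetric] bij_betw_imp_surj_on[OF bij] ..
  have "inj_on (\<lambda>e. color_of h ((\<lambda>i. f (j - i)) ` e)) (edges (path_graph j))"
    unfolding comp using assms bij
    by (intro comp_inj_on) (auto simp: rainbow_embedding_def bij_betw_def)
  moreover have "inj_on (\<lambda>i. f (j - i)) (verts (path_graph j))"
  proof (rule inj_onI)
    fix i i' assume i: "i \<in> verts (path_graph j)" "i' \<in> verts (path_graph j)" "f (j - i) = f (j - i')"
    then have "j - i = j - i'"
      using assms by (auto simp: rainbow_embedding_def path_graph_def dest: inj_onD)
    then show "i = i'"
      using i by (simp add: path_graph_def)
  qed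
  moreover have "\<forall>e\<in>edges (path_graph j). e \<subseteq> verts (path_graph j) \<and> (\<lambda>i. f (j - i)) ` e \<in> edges (board h)"
    unfolding im using assms sub by (auto simp: rainbow_embedding_def)
  ultimately show "rainbow_embedding (path_graph j) (\<lambda>i. f (j - i)) h"
    by (simp add: rainbow_embedding_def)
qed

text \<open>General attachment adds an anonymous set of colors; for a single edge the added color is
  the given \<open>c\<close>.\<close>

lemma rainbow_embedding_path_Suc:
  assumes G: "rainbow_embedding (path_graph j) f h" and h: "legal h" "legal h'" "set h \<subseteq> set h'"
    and w: "w \<notin> f ` {0..j}" "c \<notin> palette (path_graph j) f h" "({f j, w}, c) \<in> set h'"
  shows "rainbow_embedding (path_graph (Suc j)) (f(Suc j := w)) h'"
    "palette (path_graph (Suc j)) (f(Suc j := w)) h' = insert c (palette (path_graph j) f h)"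
proof -
  obtain D where "rainbow_embedding (path_graph (Suc j)) (f(Suc j := w)) h'"
    "palette (path_graph (Suc j)) (f(Suc j := w)) h' = palette (path_graph j) f h \<union> D"
    by (rule rainbow_embedding_attach[OF G h, of "Suc j" "{j}" w])
      (use w in \<open>auto simp: path_graph_Suc verts_path_graph\<close>)
  have "color_of h' ((f(Suc j := w)) ` {j, Suc j}) = c"
    using w(3) legal_color_of[OF h(2)] by simp
  moreover have "(f(Suc j := w)) ` e = f ` e" if "e \<in> edges (path_graph j)" for e
  proof -
    have "Suc j \<notin> e"
      using that by (auto simp: edges_path_graph)
    then show ?thesis
      by (intro image_cong) auto
  qed
  ultimately have "palette (path_graph (Suc j)) (f(Suc j := w)) h' = insert c (palette (path_graph j) f h')"
    unfolding palette_def edges_path_graph lessThan_Suc image_insert by (auto simp: image_iff)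
  then show "palette (path_graph (Suc j)) (f(Suc j := w)) h' = insert c (palette (path_graph j) f h)"
    using rainbow_embedding_extend[OF G h] by simp
  show "rainbow_embedding (path_graph (Suc j)) (f(Suc j := w)) h'"
    by fact
qed

lemma finite_palette_path: "finite (palette (path_graph j) f h)"
  by (simp add: palette_def edges_path_graph)

text \<open>Of the \<open>j\<close> palette colors, that of the last edge is already seen at its
  end. For \<open>j = 0\<close> the palette is empty, which agrees with truncated
  subtraction.\<close>

lemma unseen_path_end_le:
  assumes "rainbow_embedding (path_graph j) f h" "legal h"
  shows "unseen h (palette (path_graph j) f h) (f j) \<le> j - 1"
proof (cases j)
  case 0
  then show ?thesis
    by (simp add: unseen_def palette_def edges_path_graph)
next
  case (Suc i)
  then show ?thesis
    using unseen_palette_less[OF assms, of "{i, j}" j] card_edges_path_graph[of j]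
    by (auto simp: edges_path_graph)
qed

section \<open>Forcing rainbow paths and cycles\<close>

text \<open>With one tested neighbor of weight 1, the potential is just the number of failures left
  at the path's end.\<close>

lemma forces_path_extend:
  assumes G: "rainbow_embedding (path_graph j) f h" and h: "legal h"
  defines "S \<equiv> palette (path_graph j) f h"
  shows "forces (\<lambda>h'. legal h' \<and> set h \<subseteq> set h' \<and>
     (unseen h' S (f j) < \<tau> \<and> length h' + unseen h' S (f j) \<le> length h + unseen h S (f j) \<or>
      \<tau> \<le> unseen h' S (f j) \<and> length h' + unseen h' S (f j) \<le> length h + unseen h S (f j) + 1 \<and>
        (\<exists>w c. c \<notin> S \<and> rainbow_embedding (path_graph (Suc j)) (f(Suc j := w)) h' \<and>
          palette (path_graph (Suc j)) (f(Suc j := w)) h' = insert c S \<and> c \<in> seen h' (f j)))) h"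
proof -
  have "forces (\<lambda>h'. legal h' \<and> set h \<subseteq> set h' \<and>
     ((\<Sum>i\<in>{j}. 1 * unseen h' S (f i)) < \<tau> \<and>
        length h' + (\<Sum>i\<in>{j}. 1 * unseen h' S (f i)) \<le> length h + (\<Sum>i\<in>{j}. 1 * unseen h S (f i)) \<or>
      \<tau> \<le> (\<Sum>i\<in>{j}. 1 * unseen h' S (f i)) \<and>
        length h' + (\<Sum>i\<in>{j}. 1 * unseen h' S (f i)) \<le> length h + (\<Sum>i\<in>{j}. 1 * unseen h S (f i)) + length [j] \<and>
        (\<exists>w. w \<notin> f ` {0..j} \<and> (\<forall>i\<in>set [j]. \<exists>c. c \<notin> S \<and> ({f i, w}, c) \<in> set h')))) h"
    by (rule forces_attach_or_saturate) (use h finite_palette_path in \<open>auto simp: S_def\<close>)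
  then show ?thesis
  proof (rule forces_bind, intro forces_stop, elim conjE disjE exE, goal_cases)
    case (2 h' w)
    then obtain c where c: "c \<notin> S" "({f j, w}, c) \<in> set h'"
      by auto
    have "\<exists>w c. c \<notin> S \<and> rainbow_embedding (path_graph (Suc j)) (f(Suc j := w)) h' \<and>
        palette (path_graph (Suc j)) (f(Suc j := w)) h' = insert c S \<and> c \<in> seen h' (f j)"
      using rainbow_embedding_path_Suc[OF G h, of h' w c] 2 c
      by (intro exI[of _ w] exI[of _ c]) (auto simp: S_def seen_def)
    with 2 show ?case
      by simp
  qed auto
qed

text \<open>Going from \<open>j\<close> to \<open>Suc j\<close> edges costs at most
  \<open>j - 1\<close> failures and one success; the failures sum to \<open>j - 1 choose 2\<close>
  over the steps leading to \<open>j\<close> edges.\<close>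

lemma forces_rainbow_path:
  "forces (\<lambda>h. legal h \<and> (\<exists>f. rainbow_embedding (path_graph j) f h) \<and> length h \<le> (j - 1 choose 2) + j) []"
proof (induction j)
  case 0
  have "rainbow_embedding (path_graph 0) id []"
    by (simp add: rainbow_embedding_def path_graph_def)
  then show ?case
    by (intro forces_stop) (auto simp: legal_def board_def proper_coloring_def)
next
  case (Suc j)
  then show ?case
  proof (rule forces_bind, elim conjE exE, goal_cases)
    case (1 h f)
    have "unseen h (palette (path_graph j) f h) (f j) \<le> j - 1"
      by (rule unseen_path_end_le) (use 1 in auto)
    moreover have "(j choose 2) = (j - 1 choose 2) + (j - 1)"
      by (cases j) (auto simp: numeral_2_eq_2)
    ultimately show ?case
      using 1 by (intro forces_bind[OF forces_path_extend[of j f h 0]] forces_stop) auto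
  qed
qed

text \<open>A fresh vertex is tested at \<open>f j\<close> first. A failure at \<open>f 0\<close>
  therefore also wastes the good edge to \<open>f j\<close>, whence the weight 2.\<close>

lemma forces_close_cycle:
  assumes G: "rainbow_embedding (path_graph j) f h" and h: "legal h" and j: "j \<ge> 1"
  defines "S \<equiv> palette (path_graph j) f h"
  shows "forces (\<lambda>h'. (\<exists>f'. rainbow_embedding (cycle_graph (j + 2)) f' h') \<and>
     length h' \<le> length h + unseen h S (f j) + 2 * unseen h S (f 0) + 2) h"
proof -
  define p :: "nat \<Rightarrow> nat" where "p = (\<lambda>i. if i = 0 then 2 else 1)"
  have "inj_on f {0..j}"
    using G by (simp add: rainbow_embedding_def path_graph_def)
  then have inj: "inj_on f (set [j, 0])"
    by (rule inj_on_subset) auto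
  have "forces (\<lambda>h'. legal h' \<and> set h \<subseteq> set h' \<and>
      length h' + (\<Sum>i\<in>{0,j}. p i * unseen h' S (f i)) \<le> length h + (\<Sum>i\<in>{0,j}. p i * unseen h S (f i)) + length [j, 0] \<and>
        (\<exists>w. w \<notin> f ` {0..j} \<and> (\<forall>i\<in>set [j, 0]. \<exists>c. c \<notin> S \<and> ({f i, w}, c) \<in> set h'))) h"
    by (rule forces_attach)
      (use h j inj finite_palette_path in \<open>auto simp: S_def p_def less_Suc_eq\<close>)
  then show ?thesis
  proof (rule forces_bind, intro forces_stop, elim conjE exE, goal_cases)
    case (1 h' w)
    obtain D where "rainbow_embedding (cycle_graph (j + 2)) (f(Suc j := w)) h'"
      unfolding cycle_graph_eq_attach
      by (rule rainbow_embedding_attach[OF G h, of h' "Suc j" "{j, 0}" w])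
        (use 1 in \<open>auto simp: S_def verts_path_graph\<close>)
    with 1 j show ?case
      by (auto simp: p_def)
  qed
qed

lemma unseen_insert_le: "finite S \<Longrightarrow> unseen h (insert c S) v \<le> unseen h S v + 1"
  using unseen_Un_le[of S "{c}" h v] unseen_le[of "{c}" h v] by simp

text \<open>The first extension, at \<open>f 0\<close>, leaves \<open>length h1 + t\<close> at most
  \<open>length h + i\<close>, where \<open>t\<close> counts the failures left at
  \<open>f 0\<close>. In both outcomes at \<open>f i\<close> the rest costs at most
  \<open>t + 2 * i + 3\<close>, because the end that is charged twice has at most
  \<open>t + 1\<close> failures left.\<close>

lemma forces_cycle_from_path:
  assumes G: "rainbow_embedding (path_graph i) f h" and h: "legal h" and i: "i \<ge> 1"
  shows "forces (\<lambda>h'. (\<exists>f'. rainbow_embedding (cycle_graph (i + 3)) f' h') \<and>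
     length h' \<le> length h + 3 * i + 3) h"
proof -
  define S where "S = palette (path_graph i) f h"
  have fS: "finite S"
    by (simp add: S_def finite_palette_path)
  have eq: "Suc i + 2 = i + 3"
    by simp
  have end_i: "unseen h S (f i) \<le> i - 1"
    unfolding S_def by (rule unseen_path_end_le[OF G h])
  define g where "g = (\<lambda>j. f (i - j))"
  have g: "rainbow_embedding (path_graph i) g h" "palette (path_graph i) g h = S"
    using rainbow_embedding_path_rev[OF G] by (simp_all add: g_def S_def)
  have end_0: "unseen h S (f 0) \<le> i - 1"
    using unseen_path_end_le[OF g(1) h] by (simp add: g(2)) (simp add: g_def)
  have "forces (\<lambda>h'. legal h' \<and> set h \<subseteq> set h' \<and>
     (unseen h' S (f 0) < 0 \<and> length h' + unseen h' S (f 0) \<le> length h + unseen h S (f 0) \<or>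
      0 \<le> unseen h' S (f 0) \<and> length h' + unseen h' S (f 0) \<le> length h + unseen h S (f 0) + 1 \<and>
        (\<exists>w c. c \<notin> S \<and> rainbow_embedding (path_graph (Suc i)) (g(Suc i := w)) h' \<and>
          palette (path_graph (Suc i)) (g(Suc i := w)) h' = insert c S \<and> c \<in> seen h' (f 0)))) h"
    using forces_path_extend[OF g(1) h, of 0] by (simp add: g(2)) (simp add: g_def)
  then show ?thesis
  proof (rule forces_bind, elim conjE disjE exE, goal_cases)
    case (2 h1 w c)
    define t where "t = unseen h1 S (f 0)"
    have f1: "rainbow_embedding (path_graph i) f h1" "palette (path_graph i) f h1 = S"
      using rainbow_embedding_extend[OF G h] 2 by (auto simp: S_def)
    have end1: "unseen h1 S (f i) \<le> i - 1"
      using unseen_mono[OF fS, of h h1 "f i"] end_i 2 by simp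
    \<comment> \<open>Threshold \<open>Suc t\<close>: Builder stops at \<open>f i\<close> as soon as
      no more failures are left there than at \<open>f 0\<close>.\<close>
    from forces_path_extend[OF f1(1) \<open>legal h1\<close>, of "Suc t", unfolded f1(2)]
    show ?case
    proof (rule forces_bind, elim conjE disjE exE, goal_cases)
      case (1 h2)
      \<comment> \<open>No extension at \<open>f i\<close>: the extension at \<open>f 0\<close> is
        kept, and the old end \<open>f i\<close>, with at most \<open>t\<close> colors of
        \<open>S\<close> unseen, is tested last.\<close>
      let ?g = "g(Suc i := w)"
      have g2: "rainbow_embedding (path_graph (Suc i)) ?g h2" "palette (path_graph (Suc i)) ?g h2 = insert c S"
        using rainbow_embedding_extend[of _ ?g h1 h2] 1 2 by auto
      have "unseen h2 (insert c S) (?g (Suc i)) \<le> i"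
        using unseen_path_end_le[OF g2(1) \<open>legal h2\<close>] by (simp add: g2(2))
      moreover have "unseen h2 (insert c S) (?g 0) \<le> unseen h2 S (f i) + 1"
        using unseen_insert_le[OF fS] by (simp add: g_def)
      ultimately have "length h2 + unseen h2 (insert c S) (?g (Suc i)) +
          2 * unseen h2 (insert c S) (?g 0) + 2 \<le> length h + 3 * i + 3"
        using 1 2 end1 end_0 i unfolding t_def by linarith
      then show ?case
        by (intro forces_bind[OF forces_close_cycle[OF g2(1) \<open>legal h2\<close>, unfolded g2(2) eq]] forces_stop) auto
    next
      case (2 h2 w' c')
      \<comment> \<open>Success at \<open>f i\<close> with more than \<open>t\<close> failures left
        there: the edge added at \<open>f 0\<close> is discarded, and \<open>f 0\<close> is the end
        tested last.\<close>
      let ?f = "f(Suc i := w')"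
      have "unseen h2 (insert c' S) (?f (Suc i)) \<le> i"
        using unseen_path_end_le[of "Suc i" ?f h2] 2 by simp
      moreover have "unseen h2 (insert c' S) (?f 0) \<le> t + 1"
        using unseen_insert_le[OF fS, of h2 c' "f 0"] unseen_mono[OF fS, of h1 h2 "f 0"] 2
        by (simp add: t_def)
      ultimately have "length h2 + unseen h2 (insert c' S) (?f (Suc i)) +
          2 * unseen h2 (insert c' S) (?f 0) + 2 \<le> length h + 3 * i + 3"
        using 2 \<open>length h1 + _ \<le> _\<close> end1 end_0 i unfolding t_def by linarith
      then show ?case
        using 2 by (intro forces_bind[OF forces_close_cycle[of "Suc i" ?f h2, unfolded eq]] forces_stop) auto
    qed
  qed simp
qed

lemma AR_o_path_graph: "k \<ge> 1 \<Longrightarrow> AR_o (path_graph k) \<le> enat ((k choose 2) + 1)"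
proof -
  assume k: "k \<ge> 1"
  then have "(k - 1 choose 2) + k = (k choose 2) + 1"
    by (cases k) (auto simp: numeral_2_eq_2)
  then show ?thesis
    by (intro AR_o_le forces_bind[OF forces_rainbow_path[of k]] forces_stop)
      (auto intro: rainbow_embedding_imp_copy)
qed

lemma AR_o_cycle_graph:
  assumes "k \<ge> 3"
  shows "AR_o (cycle_graph k) \<le> enat ((k choose 2) + 1)"
proof -
  define i where "i = k - 3"
  have k: "k = i + 3"
    using assms by (simp add: i_def)
  have "forces (\<lambda>h'. (\<exists>f'. rainbow_embedding (cycle_graph k) f' h') \<and> length h' \<le> (k choose 2) + 1) []"
  proof (cases "i = 0")
    \<comment> \<open>The triangle: a single edge is closed. Both its ends have seen its color, so
      no failure is possible.\<close>
    case True
    show ?thesis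
    proof (rule forces_bind[OF forces_rainbow_path[of 1]], elim conjE exE, goal_cases)
      case (1 h f)
      have "unseen h (palette (path_graph 1) f h) (f 1) \<le> 0"
        using unseen_path_end_le[of 1 f h] 1 by simp
      moreover have "unseen h (palette (path_graph 1) f h) (f 0) \<le> 0"
        using unseen_palette_less[of "path_graph 1" f h "{0, 1}" 0] 1
        by (simp add: edges_path_graph lessThan_Suc)
      ultimately show ?case
        using 1 True k by (intro forces_bind[OF forces_close_cycle[of 1 f h]] forces_stop) (auto simp: eval_nat_numeral)
    qed
  next
    case False
    show ?thesis
    proof (rule forces_bind[OF forces_rainbow_path[of i]], elim conjE exE, goal_cases)
      case (1 h f)
      \<comment> \<open>From \<open>i - 1 choose 2\<close> to \<open>i + 3 choose 2\<close> the
        increments are \<open>i - 1\<close>, \<open>i\<close>, \<open>i + 1\<close> and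
        \<open>i + 2\<close>; they sum to \<open>4 * i + 2\<close>. For \<open>i = 0\<close>
        truncation would break this.\<close>
      have "(i - 1 choose 2) + i + 3 * i + 3 = (k choose 2) + 1"
        using False unfolding k by (cases i) (auto simp: numeral_2_eq_2 numeral_3_eq_3)
      then show ?case
        using 1 False unfolding k
        by (intro forces_bind[OF forces_cycle_from_path[of i f h]] forces_stop) auto
    qed
  qed
  then show ?thesis
    by (intro AR_o_le, elim forces_bind) (auto intro!: forces_stop rainbow_embedding_imp_copy)
qed

section \<open>Greedy vertex orders and the bound for general graphs\<close>

lemma greedy_vertex_order:
  fixes E :: "'a set set"
  assumes "finite V"
  obtains g :: "nat \<Rightarrow> 'a" where "bij_betw g {..<card V} V"
    "\<And>i j. j \<le> i \<Longrightarrow> i < card V \<Longrightarrow> card {l. l < j \<and> {g l, g i} \<in> E} \<le> card {l. l < j \<and> {g l, g j} \<in> E}"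
proof -
  \<comment> \<open>The induction compares the chosen vertex with all vertices not yet placed, since
    later positions are still undetermined.\<close>
  have "\<exists>g::nat \<Rightarrow> 'a. inj_on g {..<m} \<and> g ` {..<m} \<subseteq> V \<and> (\<forall>j<m. \<forall>v\<in>V - g ` {..<j}.
      card {l. l < j \<and> {g l, v} \<in> E} \<le> card {l. l < j \<and> {g l, g j} \<in> E})"
    if "m \<le> card V" for m
    using that
  proof (induction m)
    case (Suc m)
    then obtain g :: "nat \<Rightarrow> 'a" where g: "inj_on g {..<m}" "g ` {..<m} \<subseteq> V"
      "\<And>j v. j < m \<Longrightarrow> v \<in> V - g ` {..<j} \<Longrightarrow>
        card {l. l < j \<and> {g l, v} \<in> E} \<le> card {l. l < j \<and> {g l, g j} \<in> E}"
      by auto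
    define R F where "R = V - g ` {..<m}" and "F v = card {l. l < m \<and> {g l, v} \<in> E}" for v
    have "card (g ` {..<m}) < card V"
      using g(1) Suc.prems by (simp add: card_image)
    then have "R \<noteq> {}"
      using card_mono[of "g ` {..<m}" V] by (auto simp: R_def)
    moreover have "finite R"
      using assms by (simp add: R_def)
    ultimately have "Max (F ` R) \<in> F ` R" "\<forall>v\<in>R. F v \<le> Max (F ` R)"
      by auto
    then obtain x where x: "x \<in> R" "\<And>v. v \<in> R \<Longrightarrow> F v \<le> F x"
      by auto
    let ?g = "g(m := x)"
    have same: "{l. l < j \<and> {?g l, v} \<in> E} = {l. l < j \<and> {g l, v} \<in> E}" "?g ` {..<j} = g ` {..<j}"
      if "j \<le> m" for j v
      using that by auto
    show ?case
    proof (intro exI[of _ ?g] conjI allI ballI impI)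
      show "inj_on ?g {..<Suc m}" "?g ` {..<Suc m} \<subseteq> V"
        using g x(1) by (auto simp: R_def lessThan_Suc inj_on_def)
      fix j v assume j: "j < Suc m" and "v \<in> V - ?g ` {..<j}"
      then have v: "v \<in> V - g ` {..<j}"
        using same(2)[of j] by auto
      show "card {l. l < j \<and> {?g l, v} \<in> E} \<le> card {l. l < j \<and> {?g l, ?g j} \<in> E}"
      proof (cases "j = m")
        case True
        then show ?thesis
          using x(2)[of v] v same(1)[of m] by (simp add: R_def F_def)
      next
        case False
        then show ?thesis
          using g(3)[of j v] v j same(1)[of j] by simp
      qed
    qed
  qed auto
  from this[of "card V"] obtain g :: "nat \<Rightarrow> 'a" where g: "inj_on g {..<card V}" "g ` {..<card V} \<subseteq> V"
    "\<And>j v. j < card V \<Longrightarrow> v \<in> V - g ` {..<j} \<Longrightarrow>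
      card {l. l < j \<and> {g l, v} \<in> E} \<le> card {l. l < j \<and> {g l, g j} \<in> E}"
    by auto
  show ?thesis
  proof (rule that)
    show "bij_betw g {..<card V} V"
      using g assms by (simp add: bij_betw_def card_subset_eq card_image)
    show "card {l. l < j \<and> {g l, g i} \<in> E} \<le> card {l. l < j \<and> {g l, g j} \<in> E}"
      if "j \<le> i" "i < card V" for i j
      using that g(2) inj_on_image_mem_iff[OF g(1), of i "{..<j}"] by (intro g(3)) auto
  qed
qed

text \<open>A failure at \<open>j\<close> while attaching \<open>m\<close> costs at most
  \<open>back m (Suc j)\<close>, which the order bounds by \<open>back (Suc j) (Suc j)\<close>. This
  bound no longer depends on \<open>m\<close>, so it serves as a fixed weight \<open>p j\<close>,
  and the weights sum to at most \<open>card E\<close>.\<close>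

lemma forces_greedily_ordered:
  fixes E :: "nat set set"
  defines "back \<equiv> \<lambda>i j. card {l. l < j \<and> {l, i} \<in> E}"
  assumes E: "\<And>e. e \<in> E \<Longrightarrow> e \<subseteq> {..<n} \<and> card e = 2"
    and order: "\<And>i j. j \<le> i \<Longrightarrow> i < n \<Longrightarrow> back i j \<le> back j j"
  shows "forces (\<lambda>h. (\<exists>f. rainbow_embedding ({..<n}, E) f h) \<and> length h \<le> card E ^ 2) []"
proof -
  define G :: "nat \<Rightarrow> nat graph" where "G m = ({..<m}, {e\<in>E. e \<subseteq> {..<m}})" for m
  define N where "N m = {l. l < m \<and> {l, m} \<in> E}" for m
  \<comment> \<open>The last vertex has weight 0 because no later vertex is tested against
    it.\<close>
  define p where "p j = (if Suc j < n then back (Suc j) (Suc j) else 0)" for j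
  have "E \<subseteq> Pow {..<n}"
    using E by auto
  then have finE: "finite E"
    by (rule finite_subset) simp
  have G_Suc: "G (Suc m) = attach_vertex (G m) m (N m)" for m
  proof -
    have "{e\<in>E. e \<subseteq> {..<Suc m}} = {e\<in>E. e \<subseteq> {..<m}} \<union> (\<lambda>u. {u, m}) ` N m"
    proof (intro equalityI subsetI)
      fix e assume e: "e \<in> {e\<in>E. e \<subseteq> {..<Suc m}}"
      show "e \<in> {e\<in>E. e \<subseteq> {..<m}} \<union> (\<lambda>u. {u, m}) ` N m"
      proof (cases "m \<in> e")
        case True
        with e E[of e] obtain u where "e = {u, m}" "u \<noteq> m"
          by (auto simp: card_2_iff)
        with e show ?thesis
          by (auto simp: N_def)
      next
        case False
        with e show ?thesis
          by (auto simp: less_Suc_eq subset_iff)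
      qed
    qed (auto simp: N_def)
    then show ?thesis
      by (auto simp: G_def attach_vertex_def)
  qed
  have cardN: "card (N m) = back m m" and finN: "finite (N m)" for m
    by (simp_all add: N_def back_def)
  have card_Suc: "card (edges (G (Suc m))) = card (edges (G m)) + back m m" for m
  proof -
    have "inj_on (\<lambda>u. {u, m}) (N m)"
      by (auto simp: inj_on_def doubleton_eq_iff)
    moreover have "edges (G m) \<inter> (\<lambda>u. {u, m}) ` N m = {}"
      by (auto simp: G_def)
    moreover have "finite (edges (G m))"
      using finE by (simp add: G_def)
    ultimately show ?thesis
      unfolding G_Suc attach_vertex_def snd_conv using finN[of m] cardN[of m]
      by (subst card_Un_disjoint) (simp_all add: card_image)
  qed
  have cardG: "card (edges (G m)) = (\<Sum>j<m. back j j)" for m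
  proof (induction m)
    case 0
    have "edges (G 0) = {}"
      using E[of "{}"] by (auto simp: G_def)
    then show ?case
      by simp
  qed (simp add: card_Suc)
  \<comment> \<open>The allowance is \<open>p j\<close> per vertex and palette color; the unseen
    part of it must still be available for later failures.\<close>
  define Inv where "Inv m h \<longleftrightarrow> legal h \<and> (\<exists>f. rainbow_embedding (G m) f h \<and>
     length h + (\<Sum>j<m. p j * unseen h (palette (G m) f h) (f j)) \<le> (\<Sum>j<m. p j * card (edges (G m))))" for m h
  have "forces (Inv m) []" if "m \<le> n" for m
    using that
  proof (induction m)
    case 0
    have "rainbow_embedding (G 0) id []"
      using E[of "{}"] by (auto simp: rainbow_embedding_def G_def inj_on_def)
    then show ?case
      by (intro forces_stop) (auto simp: Inv_def legal_def board_def proper_coloring_def)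
  next
    case (Suc m)
    show ?case
    proof (rule forces_bind[OF Suc.IH])
      show "m \<le> n"
        using Suc.prems by simp
      fix h assume "Inv m h"
      then obtain f where h: "legal h" and f: "rainbow_embedding (G m) f h" and
        len: "length h + (\<Sum>j<m. p j * unseen h (palette (G m) f h) (f j)) \<le> (\<Sum>j<m. p j * card (edges (G m)))"
        by (auto simp: Inv_def)
      define S where "S = palette (G m) f h"
      define us where "us = sorted_list_of_set (N m)"
      have us: "set us = N m" "sorted us" "distinct us" "length us = back m m"
        using finN[of m] cardN[of m] by (simp_all add: us_def)
      have fS: "finite S"
        using finE by (simp add: S_def palette_def G_def)
      have injf: "inj_on f {..<m}"
        using f by (simp add: rainbow_embedding_def G_def)
      \<comment> \<open>As \<open>us\<close> is sorted, its first \<open>q + 1\<close> entries are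
        neighbors of \<open>m\<close> with index at most \<open>us ! q\<close>.\<close>
      have p: "q < p (us ! q)" if q: "q < length us" for q
      proof -
        define j where "j = us ! q"
        have j: "j \<in> N m"
          using nth_mem[OF q] us(1) by (simp add: j_def)
        have "i \<le> j" if "i \<in> set (take (Suc q) us)" for i
          using that q us(2) by (auto simp: in_set_conv_nth j_def intro!: sorted_nth_mono)
        moreover have "i \<in> N m" if "i \<in> set (take (Suc q) us)" for i
          using that us(1) by (auto dest: in_set_takeD)
        ultimately have sub: "set (take (Suc q) us) \<subseteq> {l. l < Suc j \<and> {l, m} \<in> E}"
          by (fastforce simp: N_def)
        have "Suc q = card (set (take (Suc q) us))"
          using q us(3) by (simp add: distinct_card)
        also have "\<dots> \<le> back m (Suc j)"
          unfolding back_def using sub by (intro card_mono) auto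
        also have "\<dots> \<le> p j"
          using order[of "Suc j" m] j Suc.prems by (auto simp: p_def N_def)
        finally show ?thesis
          by (simp add: j_def)
      qed
      have p_pos: "p j \<ge> 1" if "j \<in> N m" for j
      proof -
        from that us(1) obtain q where "q < length us" "us ! q = j"
          by (metis in_set_conv_nth)
        with p[of q] show ?thesis
          by simp
      qed
      have Nm: "N m \<subseteq> {..<m}"
        by (auto simp: N_def)
      have "forces (\<lambda>h'. legal h' \<and> set h \<subseteq> set h' \<and>
        length h' + (\<Sum>j\<in>{..<m}. p j * unseen h' S (f j)) \<le> length h + (\<Sum>j\<in>{..<m}. p j * unseen h S (f j)) + length us \<and>
          (\<exists>w. w \<notin> f ` {..<m} \<and> (\<forall>j\<in>set us. \<exists>c. c \<notin> S \<and> ({f j, w}, c) \<in> set h'))) h"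
        using us Nm injf p h fS by (intro forces_attach) (auto intro: inj_on_subset)
      then show "forces (Inv (Suc m)) h"
      proof (rule forces_bind, intro forces_stop, elim conjE exE, goal_cases)
        case (1 h' w)
        let ?f = "f(m := w)"
        obtain D where D: "rainbow_embedding (G (Suc m)) ?f h'" "palette (G (Suc m)) ?f h' = S \<union> D"
          "card D = card (N m)" "\<And>u. u \<in> N m \<Longrightarrow> D \<inter> seen h' (f u) \<noteq> {}"
          unfolding S_def G_Suc
          by (rule rainbow_embedding_attach[OF f h, of h' m "N m" w])
            (use 1 us Nm in \<open>auto simp: S_def G_def\<close>)
        have "finite (edges (G (Suc m)))"
          using finE by (simp add: G_def)
        then have fD: "finite D"
          using D(2) by (metis palette_def finite_imageI finite_Un)
        \<comment> \<open>The palette gains \<open>back m m\<close> colors, but each neighbor of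
          \<open>m\<close> has already seen one of them.\<close>
        have unseen: "unseen h' (S \<union> D) (f j) + (if j \<in> N m then 1 else 0) \<le> unseen h' S (f j) + back m m" for j
        proof -
          have "unseen h' D (f j) + (if j \<in> N m then 1 else 0) \<le> back m m"
          proof (cases "j \<in> N m")
            case True
            then show ?thesis
              using D(4)[OF True] unseen_less[OF fD] D(3) cardN[of m] by fastforce
          next
            case False
            then show ?thesis
              using unseen_le[OF fD, of h' "f j"] D(3) cardN[of m] by simp
          qed
          then show ?thesis
            using unseen_Un_le[OF fS fD, of h' "f j"] by linarith
        qed
        \<comment> \<open>The successful edges are paid for by this saving: one color at each
          neighbor, of weight at least 1.\<close>
        have "back m m = (\<Sum>j<m. if j \<in> N m then 1 else 0)"
          using cardN[of m] Nm by (simp add: sum.If_cases Int_absorb1)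
        also have "\<dots> \<le> (\<Sum>j<m. p j * (if j \<in> N m then 1 else 0))"
          using p_pos by (intro sum_mono) auto
        finally have used: "back m m \<le> (\<Sum>j<m. p j * (if j \<in> N m then 1 else 0))" .
        have "(\<Sum>j<m. p j * unseen h' (S \<union> D) (f j)) + (\<Sum>j<m. p j * (if j \<in> N m then 1 else 0)) =
            (\<Sum>j<m. p j * (unseen h' (S \<union> D) (f j) + (if j \<in> N m then 1 else 0)))"
          by (simp add: sum.distrib add_mult_distrib2)
        also have "\<dots> \<le> (\<Sum>j<m. p j * (unseen h' S (f j) + back m m))"
          by (intro sum_mono mult_le_mono2 unseen)
        also have "\<dots> = (\<Sum>j<m. p j * unseen h' S (f j)) + (\<Sum>j<m. p j * back m m)"
          by (simp add: sum.distrib add_mult_distrib2)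
        finally have pot: "length h' + (\<Sum>j<m. p j * unseen h' (S \<union> D) (f j)) \<le>
            (\<Sum>j<m. p j * card (edges (G m))) + (\<Sum>j<m. p j * back m m)"
          using 1 used us(4) len unfolding S_def by linarith
        \<comment> \<open>For the new vertex the whole palette is counted as unseen, which its own
          new allowance covers.\<close>
        have "unseen h' (S \<union> D) w \<le> card (edges (G (Suc m)))"
          using unseen_le[of "S \<union> D" h' w] fS fD card_palette[OF D(1)] D(2) by simp
        then have "p m * unseen h' (S \<union> D) w \<le> p m * card (edges (G (Suc m)))"
          by simp
        moreover have "(\<Sum>j<Suc m. p j * unseen h' (S \<union> D) (?f j)) =
            (\<Sum>j<m. p j * unseen h' (S \<union> D) (f j)) + p m * unseen h' (S \<union> D) w"
          by simp
        moreover have "(\<Sum>j<Suc m. p j * card (edges (G (Suc m)))) =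
            (\<Sum>j<m. p j * card (edges (G m))) + (\<Sum>j<m. p j * back m m) + p m * card (edges (G (Suc m)))"
          by (simp add: card_Suc sum.distrib add_mult_distrib2)
        ultimately have "length h' + (\<Sum>j<Suc m. p j * unseen h' (S \<union> D) (?f j)) \<le>
            (\<Sum>j<Suc m. p j * card (edges (G (Suc m))))"
          using pot by linarith
        with D(1,2) \<open>legal h'\<close> show ?case
          unfolding Inv_def by metis
      qed
    qed
  qed
  from this[of n] have "forces (Inv n) []"
    by simp
  moreover have G_n: "G n = ({..<n}, E)"
    using E by (auto simp: G_def)
  moreover have "(\<Sum>j<n. p j * card E) \<le> card E ^ 2"
  proof -
    \<comment> \<open>The weights are the back degrees shifted by one position, and all back degrees
      together count each edge once.\<close>
    have "(\<Sum>j<n. p j) \<le> (\<Sum>j<n. back j j)"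
    proof (cases n)
      case (Suc m)
      have "(\<Sum>j<n. p j) = (\<Sum>j<m. back (Suc j) (Suc j))"
        by (simp add: p_def Suc)
      then show ?thesis
        unfolding Suc sum.lessThan_Suc_shift by simp
    qed simp
    also have "\<dots> = card E"
      using cardG[of n] by (simp add: G_n)
    finally show ?thesis
      by (simp add: power2_eq_square flip: sum_distrib_right)
  qed
  ultimately show ?thesis
    by (elim forces_bind, intro forces_stop) (fastforce simp: Inv_def)
qed

lemma has_rainbow_copy_isomorphic:
  assumes "isomorphic H H'" "has_rainbow_copy H' G c"
  shows "has_rainbow_copy H G c"
proof -
  obtain g where g: "bij_betw g (verts H) (verts H')" "image g ` edges H = edges H'"
    using assms(1) by (auto simp: isomorphic_def)
  obtain F f where F: "subgraph F G" "rainbow F c" and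
    f: "bij_betw f (verts H') (verts F)" "image f ` edges H' = edges F"
    using assms(2) by (auto simp: has_rainbow_copy_def isomorphic_def)
  have "image (f \<circ> g) ` edges H = image f ` image g ` edges H"
    by (simp add: image_image o_def)
  then have "isomorphic H F"
    unfolding isomorphic_def using bij_betw_trans[OF g(1) f(1)] g(2) f(2) by metis
  with F show ?thesis
    unfolding has_rainbow_copy_def by blast
qed

text \<open>The greedy order numbers the vertices by \<open>{..<n}\<close>; the game is played for
  the renumbered graph, and rainbow copies carry over along the isomorphism.\<close>

lemma AR_o_le_square:
  fixes H :: "'a graph"
  assumes "simple_graph H"
  shows "AR_o H \<le> enat (card (edges H) ^ 2)"
proof -
  define n where "n = card (verts H)"
  have V: "finite (verts H)" and E: "\<And>e. e \<in> edges H \<Longrightarrow> e \<subseteq> verts H \<and> card e = 2"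
    using assms by (auto simp: simple_graph_def)
  obtain g where g: "bij_betw g {..<n} (verts H)" and
    order: "\<And>i j. j \<le> i \<Longrightarrow> i < n \<Longrightarrow>
      card {l. l < j \<and> {g l, g i} \<in> edges H} \<le> card {l. l < j \<and> {g l, g j} \<in> edges H}"
    using that unfolding n_def by (rule greedy_vertex_order[OF V, of "edges H"])
  define r where "r = the_inv_into {..<n} g"
  have r: "bij_betw r (verts H) {..<n}"
    unfolding r_def by (rule bij_betw_the_inv_into[OF g])
  have rg: "r (g i) = i" if "i < n" for i
    using that g by (simp add: r_def the_inv_into_f_f bij_betw_def)
  have gr: "g (r v) = v" if "v \<in> verts H" for v
    using that f_the_inv_into_f_bij_betw[OF g] by (simp add: r_def)
  define E' where "E' = image r ` edges H"
  have gre: "g ` r ` e = e" if "e \<in> edges H" for e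
    using E[OF that] gr by (force simp: image_image)
  have adj: "{l, i} \<in> E' \<longleftrightarrow> {g l, g i} \<in> edges H" if "l < n" "i < n" for l i
  proof
    assume "{l, i} \<in> E'"
    then obtain e where e: "e \<in> edges H" "{l, i} = r ` e"
      by (auto simp: E'_def)
    then show "{g l, g i} \<in> edges H"
      using gre[OF e(1)] by (metis image_empty image_insert)
  next
    assume "{g l, g i} \<in> edges H"
    then show "{l, i} \<in> E'"
      using that rg unfolding E'_def by (intro image_eqI[of _ _ "{g l, g i}"]) auto
  qed
  have "inj_on (image r) (edges H)"
    using gre by (metis inj_on_inverseI)
  then have card: "card E' = card (edges H)"
    by (simp add: E'_def card_image)
  have "forces (\<lambda>h. (\<exists>f. rainbow_embedding ({..<n}, E') f h) \<and> length h \<le> card E' ^ 2) []"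
  proof (rule forces_greedily_ordered)
    fix e assume "e \<in> E'"
    then obtain e' where e': "e' \<in> edges H" "e = r ` e'"
      by (auto simp: E'_def)
    have "inj_on r e'"
      using r E[OF e'(1)] by (auto simp: bij_betw_def intro: inj_on_subset)
    then show "e \<subseteq> {..<n} \<and> card e = 2"
      using e' E[OF e'(1)] r by (auto simp: card_image bij_betw_def)
  next
    fix i j assume ij: "j \<le> i" "i < n"
    have "{l. l < j \<and> {l, i} \<in> E'} = {l. l < j \<and> {g l, g i} \<in> edges H}"
      "{l. l < j \<and> {l, j} \<in> E'} = {l. l < j \<and> {g l, g j} \<in> edges H}"
      using ij adj by auto
    then show "card {l. l < j \<and> {l, i} \<in> E'} \<le> card {l. l < j \<and> {l, j} \<in> E'}"
      using order[OF ij] by simp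
  qed
  moreover have "isomorphic H ({..<n}, E')"
    unfolding isomorphic_def using r by (auto simp: E'_def)
  ultimately show ?thesis
    unfolding card
    by (intro AR_o_le, elim forces_bind)
      (auto intro!: forces_stop intro: rainbow_embedding_imp_copy has_rainbow_copy_isomorphic)
qed

text \<open>The general bound is applied with \<open>n choose 2\<close> edges, at most half of
  \<open>n ^ 2\<close>. The comparison is made in \<open>ereal\<close> since the right-hand side is
  not an integer for odd \<open>n\<close>.\<close>

lemma AR_o_complete_graph: "ereal_of_enat (AR_o (complete_graph n)) \<le> ereal (real n ^ 4 / 4)"
proof -
  have "simple_graph (complete_graph n)"
    by (auto simp: simple_graph_def complete_graph_def)
  then have "AR_o (complete_graph n) \<le> enat (card (edges (complete_graph n)) ^ 2)"
    by (rule AR_o_le_square)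
  also have "card (edges (complete_graph n)) = n choose 2"
    using n_subsets[of "{0..<n}" 2] by (simp add: complete_graph_def)
  finally have "ereal_of_enat (AR_o (complete_graph n)) \<le> ereal (real ((n choose 2) ^ 2))"
    using ereal_of_enat_le_iff by (metis ereal_of_enat_simps(1))
  also have "2 * (n choose 2) \<le> n ^ 2"
    unfolding choose_two power2_eq_square
    by (rule order_trans[OF times_div_less_eq_dividend]) simp
  then have "real (n choose 2) \<le> real n ^ 2 / 2"
    using of_nat_mono[of "2 * (n choose 2)" "n ^ 2", where ?'a = real] by simp
  then have "real (n choose 2) ^ 2 \<le> (real n ^ 2 / 2) ^ 2"
    by (intro power_mono) auto
  then have "ereal (real ((n choose 2) ^ 2)) \<le> ereal (real n ^ 4 / 4)"
    by (simp add: power_divide flip: power_mult)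
  finally show ?thesis .
qed

theorem theorem17:
  shows "(\<forall>(H :: 'a graph) k. simple_graph H \<and> no_isolated_vertices H \<and> card (edges H) = k
            \<longrightarrow> AR_o H \<le> enat (k ^ 2))
    \<and> (\<forall>k\<ge>1. AR_o (path_graph k) \<le> enat ((k choose 2) + 1))
    \<and> (\<forall>k\<ge>3. AR_o (cycle_graph k) \<le> enat ((k choose 2) + 1))
    \<and> (\<forall>n\<ge>2. ereal_of_enat (AR_o (complete_graph n)) \<le> ereal (real n ^ 4 / 4))"
  using AR_o_le_square AR_o_path_graph AR_o_cycle_graph AR_o_complete_graph by blast

end
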